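(* Consider algebras $\mathcal{M} = (M;\,\cdot,\backslash,/)$ with three binary operations, and the following equations (each universally quantified over all variables in $M$): (Q1) $x\backslash (xx) = x$; (Q2) $(xx)/ x = x$; (Q3) $x (x\backslash y) = x\backslash (xy)$; (Q4) $(x/ y) y = (xy)/ y$; (Q5) $(x\backslash y)\backslash \big((x\backslash y)(zu)\big) = \big(x\backslash (xz)\big)u$; (Q6) $\big((xy)(z/ u)\big)/ (z/ u) = x\big((yu)/ u\big)$; (L) $x\backslash \big(x (y\backslash y)\big) = \big((x/ x)y\big)/ y$. Then: (1) The equations (Q1), (Q2), (Q3), (Q4), (Q5), (Q6) form an independent system of axioms for the variety of rectangular quasigroups. (2) The equations (Q1), (Q2), (Q3), (Q4), (Q5), (Q6), (L) form an independent system of axioms for the variety of rectangular loops.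
   Context: Juxtaposition denotes the operation $\cdot$, that is, $xy = x\cdot y$. A quasigroup is an algebra $(Q;\,\cdot,\backslash,/)$ with three binary operations satisfying $x\backslash(xy)=y$, $x(x\backslash y)=y$, $(xy)/y = x$, and $(x/y)y=x$. A loop is a quasigroup with an element $1$ satisfying $1x = x$ and $x1 = x$ for all $x$ (equivalently, a quasigroup satisfying $x\backslash x = y/y$). A left zero semigroup is a semigroup satisfying $xy = x$; a right zero semigroup is a semigroup satisfying $xy=y$. A rectangular band is a semigroup that is (isomorphic to) a direct product of a left zero semigroup and a right zero semigroup; it is regarded as an algebra with three binary operations by setting $x\backslash y = x/y = xy$. A rectangular quasigroup is an algebra $(M;\,\cdot,\backslash,/)$ that is (isomorphic to) the direct product, as algebras with three binary operations, of a quasigroup and a rectangular band. A rectangular loop is an algebra $(M;\,\cdot,\backslash,/)$ that is (isomorphic to) the direct product, as algebras with three binary operations, of a loop and a rectangular band. A set of equations is a system of axioms for a class of algebras if an algebra $(M;\,\cdot,\backslash,/)$ belongs to the class if and only if it satisfies all the equations. The system is independent if no equation in it is a consequence of the others, i.e., for each equation in the system there is an algebra $(M;\,\cdot,\backslash,/)$ satisfying all the other equations of the system but not that one. *)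

theory Defs
  imports "HOL-Algebra.Congruence" "HOL-Library.Countable"
begin

section \<open>Algebras with one and with three binary operations\<close>

record 'a magma = "'a partial_object" +
  mul :: "'a \<Rightarrow> 'a \<Rightarrow> 'a" (infixl \<open>\<cdot>\<index>\<close> 70)

record 'a algebra3 = "'a magma" +
  ldiv :: "'a \<Rightarrow> 'a \<Rightarrow> 'a" (infixl \<open>\<setminus>\<index>\<close> 70)
  rdiv :: "'a \<Rightarrow> 'a \<Rightarrow> 'a" (infixl \<open>\<sslash>\<index>\<close> 70)

text \<open>As usual in universal algebra, carriers are nonempty.  The operations are total functions on
  the type; only their values on the carrier matter.\<close>

definition is_magma :: "('a, 'm) magma_scheme \<Rightarrow> bool" where
  "is_magma S \<longleftrightarrow> carrier S \<noteq> {} \<and>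
     (\<forall>x\<in>carrier S. \<forall>y\<in>carrier S. x \<cdot>\<^bsub>S\<^esub> y \<in> carrier S)"

definition is_algebra3 :: "('a, 'm) algebra3_scheme \<Rightarrow> bool" where
  "is_algebra3 M \<longleftrightarrow> is_magma M \<and>
     (\<forall>x\<in>carrier M. \<forall>y\<in>carrier M. x \<setminus>\<^bsub>M\<^esub> y \<in> carrier M \<and> x \<sslash>\<^bsub>M\<^esub> y \<in> carrier M)"

definition magma_prod :: "('a, 'm) magma_scheme \<Rightarrow> ('b, 'n) magma_scheme \<Rightarrow> ('a \<times> 'b) magma" where
  "magma_prod S T =
     \<lparr> carrier = carrier S \<times> carrier T,
       mul = (\<lambda>p q. (fst p \<cdot>\<^bsub>S\<^esub> fst q, snd p \<cdot>\<^bsub>T\<^esub> snd q)) \<rparr>"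

definition algebra3_prod ::
  "('a, 'm) algebra3_scheme \<Rightarrow> ('b, 'n) algebra3_scheme \<Rightarrow> ('a \<times> 'b) algebra3" where
  "algebra3_prod M N =
     \<lparr> carrier = carrier M \<times> carrier N,
       mul = (\<lambda>p q. (fst p \<cdot>\<^bsub>M\<^esub> fst q, snd p \<cdot>\<^bsub>N\<^esub> snd q)),
       ldiv = (\<lambda>p q. (fst p \<setminus>\<^bsub>M\<^esub> fst q, snd p \<setminus>\<^bsub>N\<^esub> snd q)),
       rdiv = (\<lambda>p q. (fst p \<sslash>\<^bsub>M\<^esub> fst q, snd p \<sslash>\<^bsub>N\<^esub> snd q)) \<rparr>"

definition magma_iso ::
  "('a \<Rightarrow> 'b) \<Rightarrow> ('a, 'm) magma_scheme \<Rightarrow> ('b, 'n) magma_scheme \<Rightarrow> bool" where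
  "magma_iso h S T \<longleftrightarrow> bij_betw h (carrier S) (carrier T) \<and>
     (\<forall>x\<in>carrier S. \<forall>y\<in>carrier S. h (x \<cdot>\<^bsub>S\<^esub> y) = h x \<cdot>\<^bsub>T\<^esub> h y)"

definition algebra3_iso ::
  "('a \<Rightarrow> 'b) \<Rightarrow> ('a, 'm) algebra3_scheme \<Rightarrow> ('b, 'n) algebra3_scheme \<Rightarrow> bool" where
  "algebra3_iso h M N \<longleftrightarrow> magma_iso h M N \<and>
     (\<forall>x\<in>carrier M. \<forall>y\<in>carrier M.
        h (x \<setminus>\<^bsub>M\<^esub> y) = h x \<setminus>\<^bsub>N\<^esub> h y \<and> h (x \<sslash>\<^bsub>M\<^esub> y) = h x \<sslash>\<^bsub>N\<^esub> h y)"


section \<open>Quasigroups, loops, rectangular bands\<close>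

definition is_quasigroup :: "('a, 'm) algebra3_scheme \<Rightarrow> bool" where
  "is_quasigroup Q \<longleftrightarrow> is_algebra3 Q \<and>
     (\<forall>x\<in>carrier Q. \<forall>y\<in>carrier Q.
        x \<setminus>\<^bsub>Q\<^esub> (x \<cdot>\<^bsub>Q\<^esub> y) = y \<and> x \<cdot>\<^bsub>Q\<^esub> (x \<setminus>\<^bsub>Q\<^esub> y) = y \<and>
        (x \<cdot>\<^bsub>Q\<^esub> y) \<sslash>\<^bsub>Q\<^esub> y = x \<and> (x \<sslash>\<^bsub>Q\<^esub> y) \<cdot>\<^bsub>Q\<^esub> y = x)"

definition is_loop :: "('a, 'm) algebra3_scheme \<Rightarrow> bool" where
  "is_loop Q \<longleftrightarrow> is_quasigroup Q \<and>
     (\<exists>e\<in>carrier Q. \<forall>x\<in>carrier Q. e \<cdot>\<^bsub>Q\<^esub> x = x \<and> x \<cdot>\<^bsub>Q\<^esub> e = x)"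

definition is_semigroup :: "('a, 'm) magma_scheme \<Rightarrow> bool" where
  "is_semigroup S \<longleftrightarrow> is_magma S \<and>
     (\<forall>x\<in>carrier S. \<forall>y\<in>carrier S. \<forall>z\<in>carrier S.
        (x \<cdot>\<^bsub>S\<^esub> y) \<cdot>\<^bsub>S\<^esub> z = x \<cdot>\<^bsub>S\<^esub> (y \<cdot>\<^bsub>S\<^esub> z))"

definition left_zero_semigroup :: "('a, 'm) magma_scheme \<Rightarrow> bool" where
  "left_zero_semigroup S \<longleftrightarrow> is_semigroup S \<and>
     (\<forall>x\<in>carrier S. \<forall>y\<in>carrier S. x \<cdot>\<^bsub>S\<^esub> y = x)"

definition right_zero_semigroup :: "('a, 'm) magma_scheme \<Rightarrow> bool" where
  "right_zero_semigroup S \<longleftrightarrow> is_semigroup S \<and>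
     (\<forall>x\<in>carrier S. \<forall>y\<in>carrier S. x \<cdot>\<^bsub>S\<^esub> y = y)"

text \<open>HOL cannot quantify over the types of the factors of a direct product, so here and in
  \<open>rectangular_quasigroup\<close> and \<open>rectangular_loop\<close> the factors have their carriers in the type of
  the product itself.  Nothing is lost: each factor of a nonempty product is in bijection with a
  subset of the product.  See \<open>rectangular_bandI\<close>, \<open>rectangular_quasigroupI\<close> and
  \<open>rectangular_loopI\<close> below, which admit factors over arbitrary types.\<close>

definition rectangular_band :: "('a, 'm) magma_scheme \<Rightarrow> bool" where
  "rectangular_band B \<longleftrightarrow> is_semigroup B \<and>
     (\<exists>(L :: 'a magma) (R :: 'a magma) h.
        left_zero_semigroup L \<and> right_zero_semigroup R \<and> magma_iso h B (magma_prod L R))"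

definition rectangular_band3 :: "('a, 'm) algebra3_scheme \<Rightarrow> bool" where
  "rectangular_band3 B \<longleftrightarrow> is_algebra3 B \<and> rectangular_band B \<and>
     (\<forall>x\<in>carrier B. \<forall>y\<in>carrier B.
        x \<setminus>\<^bsub>B\<^esub> y = x \<cdot>\<^bsub>B\<^esub> y \<and> x \<sslash>\<^bsub>B\<^esub> y = x \<cdot>\<^bsub>B\<^esub> y)"

definition rectangular_quasigroup :: "'a algebra3 \<Rightarrow> bool" where
  "rectangular_quasigroup M \<longleftrightarrow> is_algebra3 M \<and>
     (\<exists>(Q :: 'a algebra3) (B :: 'a algebra3) h.
        is_quasigroup Q \<and> rectangular_band3 B \<and> algebra3_iso h M (algebra3_prod Q B))"

definition rectangular_loop :: "'a algebra3 \<Rightarrow> bool" where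
  "rectangular_loop M \<longleftrightarrow> is_algebra3 M \<and>
     (\<exists>(Q :: 'a algebra3) (B :: 'a algebra3) h.
        is_loop Q \<and> rectangular_band3 B \<and> algebra3_iso h M (algebra3_prod Q B))"


section \<open>Equations and systems of axioms\<close>

datatype trm =
    Var nat
  | Mul trm trm (infixl \<open>\<^bold>\<cdot>\<close> 70)
  | LDiv trm trm (infixl \<open>\<^bold>\<setminus>\<close> 70)
  | RDiv trm trm (infixl \<open>\<^bold>\<sslash>\<close> 70)

datatype equation = Equation trm trm (infix \<open>\<^bold>\<approx>\<close> 50)

primrec eval_trm :: "('a, 'm) algebra3_scheme \<Rightarrow> (nat \<Rightarrow> 'a) \<Rightarrow> trm \<Rightarrow> 'a" where
  "eval_trm M v (Var i) = v i"
| "eval_trm M v (s \<^bold>\<cdot> t) = eval_trm M v s \<cdot>\<^bsub>M\<^esub> eval_trm M v t"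
| "eval_trm M v (s \<^bold>\<setminus> t) = eval_trm M v s \<setminus>\<^bsub>M\<^esub> eval_trm M v t"
| "eval_trm M v (s \<^bold>\<sslash> t) = eval_trm M v s \<sslash>\<^bsub>M\<^esub> eval_trm M v t"

primrec satisfies :: "('a, 'm) algebra3_scheme \<Rightarrow> equation \<Rightarrow> bool" (infix \<open>\<^bold>\<Turnstile>\<close> 50) where
  "M \<^bold>\<Turnstile> (s \<^bold>\<approx> t) \<longleftrightarrow>
     (\<forall>v. (\<forall>i. v i \<in> carrier M) \<longrightarrow> eval_trm M v s = eval_trm M v t)"

definition axiom_system :: "equation set \<Rightarrow> ('a algebra3 \<Rightarrow> bool) \<Rightarrow> bool" where
  "axiom_system E K \<longleftrightarrow> (\<forall>M. is_algebra3 M \<longrightarrow> (K M \<longleftrightarrow> (\<forall>e\<in>E. M \<^bold>\<Turnstile> e)))"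

text \<open>Restricting the witnesses of independence to algebras with carrier in \<^typ>\<open>nat\<close> loses
  nothing: a countable subalgebra of a witness is again a witness
  (\<open>independent_equationsI\<close> below).\<close>

definition independent_equations :: "equation set \<Rightarrow> bool" where
  "independent_equations E \<longleftrightarrow>
     (\<forall>e\<in>E. \<exists>M :: nat algebra3. is_algebra3 M \<and> (\<forall>e'\<in>E - {e}. M \<^bold>\<Turnstile> e') \<and> \<not> M \<^bold>\<Turnstile> e)"

abbreviation "vx \<equiv> Var 0"
abbreviation "vy \<equiv> Var 1"
abbreviation "vz \<equiv> Var 2"
abbreviation "vu \<equiv> Var 3"

definition eqQ1 :: equation where
  "eqQ1 = (vx \<^bold>\<setminus> (vx \<^bold>\<cdot> vx) \<^bold>\<approx> vx)"

definition eqQ2 :: equation where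
  "eqQ2 = ((vx \<^bold>\<cdot> vx) \<^bold>\<sslash> vx \<^bold>\<approx> vx)"

definition eqQ3 :: equation where
  "eqQ3 = (vx \<^bold>\<cdot> (vx \<^bold>\<setminus> vy) \<^bold>\<approx> vx \<^bold>\<setminus> (vx \<^bold>\<cdot> vy))"

definition eqQ4 :: equation where
  "eqQ4 = ((vx \<^bold>\<sslash> vy) \<^bold>\<cdot> vy \<^bold>\<approx> (vx \<^bold>\<cdot> vy) \<^bold>\<sslash> vy)"

definition eqQ5 :: equation where
  "eqQ5 = ((vx \<^bold>\<setminus> vy) \<^bold>\<setminus> ((vx \<^bold>\<setminus> vy) \<^bold>\<cdot> (vz \<^bold>\<cdot> vu)) \<^bold>\<approx>
           (vx \<^bold>\<setminus> (vx \<^bold>\<cdot> vz)) \<^bold>\<cdot> vu)"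

definition eqQ6 :: equation where
  "eqQ6 = (((vx \<^bold>\<cdot> vy) \<^bold>\<cdot> (vz \<^bold>\<sslash> vu)) \<^bold>\<sslash> (vz \<^bold>\<sslash> vu) \<^bold>\<approx>
           vx \<^bold>\<cdot> ((vy \<^bold>\<cdot> vu) \<^bold>\<sslash> vu))"

definition eqL :: equation where
  "eqL = (vx \<^bold>\<setminus> (vx \<^bold>\<cdot> (vy \<^bold>\<setminus> vy)) \<^bold>\<approx> ((vx \<^bold>\<sslash> vx) \<^bold>\<cdot> vy) \<^bold>\<sslash> vy)"


section \<open>Independence of the choice of carrier types\<close>

text \<open>Transport of structure along an injection.\<close>

definition magma_copy :: "('b \<Rightarrow> 'a) \<Rightarrow> ('b, 'm) magma_scheme \<Rightarrow> 'a magma" where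
  "magma_copy f S = (let g = inv_into (carrier S) f in
     \<lparr> carrier = f ` carrier S, mul = (\<lambda>x y. f (g x \<cdot>\<^bsub>S\<^esub> g y)) \<rparr>)"

definition algebra3_copy :: "('b \<Rightarrow> 'a) \<Rightarrow> ('b, 'm) algebra3_scheme \<Rightarrow> 'a algebra3" where
  "algebra3_copy f M = (let g = inv_into (carrier M) f in
     \<lparr> carrier = f ` carrier M,
       mul = (\<lambda>x y. f (g x \<cdot>\<^bsub>M\<^esub> g y)),
       ldiv = (\<lambda>x y. f (g x \<setminus>\<^bsub>M\<^esub> g y)),
       rdiv = (\<lambda>x y. f (g x \<sslash>\<^bsub>M\<^esub> g y)) \<rparr>)"

lemma magma_iso_copy: "inj_on f (carrier S) \<Longrightarrow> magma_iso f S (magma_copy f S)"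
  by (simp add: magma_iso_def magma_copy_def Let_def bij_betw_def)

lemma algebra3_iso_copy: "inj_on f (carrier M) \<Longrightarrow> algebra3_iso f M (algebra3_copy f M)"
  by (simp add: algebra3_iso_def magma_iso_def algebra3_copy_def Let_def bij_betw_def)

lemma magma_iso_image:
  assumes "magma_iso h S T"
  shows "carrier T = h ` carrier S"
  using assms by (simp add: magma_iso_def bij_betw_def)

lemma is_magma_iso:
  assumes h: "magma_iso h S T" and S: "is_magma S"
  shows "is_magma T"
proof -
  have hm: "h x \<cdot>\<^bsub>T\<^esub> h y = h (x \<cdot>\<^bsub>S\<^esub> y)" if "x \<in> carrier S" "y \<in> carrier S" for x y
    using h that by (simp add: magma_iso_def)
  show ?thesis
    using S by (simp add: is_magma_def magma_iso_image[OF h] hm)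
qed

lemma is_algebra3_iso:
  assumes h: "algebra3_iso h M N" and M: "is_algebra3 M"
  shows "is_algebra3 N"
proof -
  have hm: "h x \<setminus>\<^bsub>N\<^esub> h y = h (x \<setminus>\<^bsub>M\<^esub> y)" "h x \<sslash>\<^bsub>N\<^esub> h y = h (x \<sslash>\<^bsub>M\<^esub> y)"
    if "x \<in> carrier M" "y \<in> carrier M" for x y
    using h that by (simp_all add: algebra3_iso_def)
  have "magma_iso h M N" using h by (simp add: algebra3_iso_def)
  from magma_iso_image[OF this] is_magma_iso[OF this] show ?thesis
    using M by (simp add: is_algebra3_def hm)
qed

lemma is_semigroup_iso:
  assumes h: "magma_iso h S T" and S: "is_semigroup S"
  shows "is_semigroup T"
proof -
  have hm: "h x \<cdot>\<^bsub>T\<^esub> h y = h (x \<cdot>\<^bsub>S\<^esub> y)" if "x \<in> carrier S" "y \<in> carrier S" for x y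
    using h that by (simp add: magma_iso_def)
  have "is_magma T" using is_magma_iso[OF h] S by (simp add: is_semigroup_def)
  then show ?thesis
    using S by (simp add: is_semigroup_def magma_iso_image[OF h] hm is_magma_def)
qed

lemma left_zero_semigroup_iso:
  assumes h: "magma_iso h S T" and S: "left_zero_semigroup S"
  shows "left_zero_semigroup T"
proof -
  have hm: "h x \<cdot>\<^bsub>T\<^esub> h y = h (x \<cdot>\<^bsub>S\<^esub> y)" if "x \<in> carrier S" "y \<in> carrier S" for x y
    using h that by (simp add: magma_iso_def)
  show ?thesis
    using S is_semigroup_iso[OF h]
    by (simp add: left_zero_semigroup_def magma_iso_image[OF h] hm)
qed

lemma right_zero_semigroup_iso:
  assumes h: "magma_iso h S T" and S: "right_zero_semigroup S"
  shows "right_zero_semigroup T"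
proof -
  have hm: "h x \<cdot>\<^bsub>T\<^esub> h y = h (x \<cdot>\<^bsub>S\<^esub> y)" if "x \<in> carrier S" "y \<in> carrier S" for x y
    using h that by (simp add: magma_iso_def)
  show ?thesis
    using S is_semigroup_iso[OF h]
    by (simp add: right_zero_semigroup_def magma_iso_image[OF h] hm)
qed

lemma magma_iso_inv:
  assumes h: "magma_iso h S T" and S: "is_magma S"
  shows "magma_iso (inv_into (carrier S) h) T S"
proof -
  let ?g = "inv_into (carrier S) h"
  have inj: "inj_on h (carrier S)" using h by (simp add: magma_iso_def bij_betw_def)
  have "bij_betw ?g (carrier T) (carrier S)"
    using h by (simp add: magma_iso_def bij_betw_inv_into)
  moreover have "?g (h x \<cdot>\<^bsub>T\<^esub> h y) = ?g (h x) \<cdot>\<^bsub>S\<^esub> ?g (h y)"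
    if xy: "x \<in> carrier S" "y \<in> carrier S" for x y
  proof -
    have "h x \<cdot>\<^bsub>T\<^esub> h y = h (x \<cdot>\<^bsub>S\<^esub> y)" "x \<cdot>\<^bsub>S\<^esub> y \<in> carrier S"
      using h S xy by (simp_all add: magma_iso_def is_magma_def)
    then show ?thesis using xy inj by simp
  qed
  ultimately show ?thesis
    by (simp add: magma_iso_def[of ?g] magma_iso_image[OF h])
qed

lemma magma_iso_trans:
  assumes "magma_iso h S T" "magma_iso k T U"
  shows "magma_iso (k \<circ> h) S U"
proof -
  have "h x \<in> carrier T" if "x \<in> carrier S" for x
    using assms(1) that by (auto simp: magma_iso_def dest: bij_betwE)
  then show ?thesis
    using assms bij_betw_trans[of h "carrier S" "carrier T" k "carrier U"]
    by (simp add: magma_iso_def)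
qed

lemma algebra3_iso_trans:
  assumes "algebra3_iso h M N" "algebra3_iso k N P"
  shows "algebra3_iso (k \<circ> h) M P"
proof -
  have "h x \<in> carrier N" if "x \<in> carrier M" for x
    using assms(1) that by (auto simp: algebra3_iso_def magma_iso_def dest: bij_betwE)
  then show ?thesis
    using assms magma_iso_trans[of h M N k P] by (simp add: algebra3_iso_def)
qed

lemma magma_iso_map_prod:
  assumes "magma_iso f S S'" "magma_iso g T T'"
  shows "magma_iso (map_prod f g) (magma_prod S T) (magma_prod S' T')"
  using assms by (auto simp: magma_iso_def magma_prod_def intro: bij_betw_map_prod)

lemma algebra3_iso_map_prod:
  assumes "algebra3_iso f M M'" "algebra3_iso g N N'"
  shows "algebra3_iso (map_prod f g) (algebra3_prod M N) (algebra3_prod M' N')"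
  using assms
  by (auto simp: algebra3_iso_def magma_iso_def algebra3_prod_def intro: bij_betw_map_prod)

lemma is_quasigroup_iso:
  assumes h: "algebra3_iso h M N" and M: "is_quasigroup M"
  shows "is_quasigroup N"
proof -
  have hm: "h x \<cdot>\<^bsub>N\<^esub> h y = h (x \<cdot>\<^bsub>M\<^esub> y)" "h x \<setminus>\<^bsub>N\<^esub> h y = h (x \<setminus>\<^bsub>M\<^esub> y)"
    "h x \<sslash>\<^bsub>N\<^esub> h y = h (x \<sslash>\<^bsub>M\<^esub> y)" if "x \<in> carrier M" "y \<in> carrier M" for x y
    using h that by (simp_all add: algebra3_iso_def magma_iso_def)
  have "carrier N = h ` carrier M"
    using h by (simp add: algebra3_iso_def magma_iso_image)
  moreover have "is_algebra3 N" "is_algebra3 M"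
    using is_algebra3_iso[OF h] M by (simp_all add: is_quasigroup_def)
  ultimately show ?thesis
    using M by (simp add: is_quasigroup_def hm is_algebra3_def is_magma_def)
qed

lemma is_loop_iso:
  assumes h: "algebra3_iso h M N" and M: "is_loop M"
  shows "is_loop N"
proof -
  have N: "carrier N = h ` carrier M"
    using h by (simp add: algebra3_iso_def magma_iso_image)
  obtain e where e: "e \<in> carrier M" "\<forall>x\<in>carrier M. e \<cdot>\<^bsub>M\<^esub> x = x \<and> x \<cdot>\<^bsub>M\<^esub> e = x"
    using M by (auto simp: is_loop_def)
  have "\<forall>y\<in>carrier N. h e \<cdot>\<^bsub>N\<^esub> y = y \<and> y \<cdot>\<^bsub>N\<^esub> h e = y"
    using h e unfolding N algebra3_iso_def magma_iso_def by (metis (no_types, lifting) imageE)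
  then show ?thesis
    using M e N is_quasigroup_iso[OF h] unfolding is_loop_def by blast
qed

lemma factors_embed:
  assumes h: "bij_betw h C (A \<times> B)" and C: "C \<noteq> {}"
  obtains f g where "inj_on f A" "inj_on g B" "f ` A \<subseteq> C" "g ` B \<subseteq> C"
proof -
  let ?k = "inv_into C h"
  have k: "inj_on ?k (A \<times> B)" "?k ` (A \<times> B) \<subseteq> C"
    using bij_betw_inv_into[OF h] by (simp_all add: bij_betw_def)
  have "A \<times> B \<noteq> {}"
    using h C by (metis bij_betw_def image_is_empty)
  then obtain a b where ab: "a \<in> A" "b \<in> B"
    by auto
  show ?thesis
  proof
    show "inj_on (\<lambda>x. ?k (x, b)) A" "inj_on (\<lambda>y. ?k (a, y)) B"
      using k(1) ab by (auto intro!: inj_onI dest: inj_onD)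
    show "(\<lambda>x. ?k (x, b)) ` A \<subseteq> C" "(\<lambda>y. ?k (a, y)) ` B \<subseteq> C"
      using k(2) ab by auto
  qed
qed

lemma rectangular_bandI:
  fixes L :: "('b, 'm) magma_scheme" and R :: "('c, 'n) magma_scheme"
    and B :: "('a, 'k) magma_scheme"
  assumes B: "is_semigroup B" and L: "left_zero_semigroup L" and R: "right_zero_semigroup R"
    and h: "magma_iso h B (magma_prod L R)"
  shows "rectangular_band B"
proof -
  have "bij_betw h (carrier B) (carrier L \<times> carrier R)" "carrier B \<noteq> {}"
    using h B by (simp_all add: magma_iso_def magma_prod_def is_semigroup_def is_magma_def)
  then obtain f g where f: "inj_on (f :: 'b \<Rightarrow> 'a) (carrier L)"
    and g: "inj_on (g :: 'c \<Rightarrow> 'a) (carrier R)"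
    by (rule factors_embed)
  note isos = magma_iso_copy[OF f] magma_iso_copy[OF g]
  show ?thesis
    unfolding rectangular_band_def
    using B left_zero_semigroup_iso[OF isos(1) L] right_zero_semigroup_iso[OF isos(2) R]
      magma_iso_trans[OF h magma_iso_map_prod[OF isos]]
    by blast
qed

lemma rectangular_band_iso:
  assumes h: "magma_iso h B B'" and B: "rectangular_band B"
  shows "rectangular_band B'"
proof -
  obtain L R :: "'a magma" and k where *: "left_zero_semigroup L" "right_zero_semigroup R"
    "magma_iso k B (magma_prod L R)"
    using B by (auto simp: rectangular_band_def)
  have B1: "is_semigroup B" using B by (simp add: rectangular_band_def)
  then have "magma_iso (inv_into (carrier B) h) B' B"
    using magma_iso_inv[OF h] by (simp add: is_semigroup_def)
  from magma_iso_trans[OF this *(3)] show ?thesis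
    using rectangular_bandI is_semigroup_iso[OF h B1] *(1,2) by blast
qed

lemma rectangular_band3_iso:
  assumes h: "algebra3_iso h B B'" and B: "rectangular_band3 B"
  shows "rectangular_band3 B'"
proof -
  have hm: "h x \<cdot>\<^bsub>B'\<^esub> h y = h (x \<cdot>\<^bsub>B\<^esub> y)" "h x \<setminus>\<^bsub>B'\<^esub> h y = h (x \<setminus>\<^bsub>B\<^esub> y)"
    "h x \<sslash>\<^bsub>B'\<^esub> h y = h (x \<sslash>\<^bsub>B\<^esub> y)" if "x \<in> carrier B" "y \<in> carrier B" for x y
    using h that by (simp_all add: algebra3_iso_def magma_iso_def)
  have "carrier B' = h ` carrier B"
    using h by (simp add: algebra3_iso_def magma_iso_image)
  moreover have "is_algebra3 B'" "rectangular_band B'"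
    using B h is_algebra3_iso[OF h] rectangular_band_iso[of h B B']
    by (simp_all add: rectangular_band3_def algebra3_iso_def)
  ultimately show ?thesis
    using B by (simp add: rectangular_band3_def hm)
qed

lemma algebra3_factors:
  fixes Q :: "('b, 'm) algebra3_scheme" and B :: "('c, 'n) algebra3_scheme"
    and M :: "'a algebra3"
  assumes M: "is_algebra3 M" and h: "algebra3_iso h M (algebra3_prod Q B)"
  obtains Q' B' :: "'a algebra3" and f g h' where "algebra3_iso f Q Q'" "algebra3_iso g B B'"
    "algebra3_iso h' M (algebra3_prod Q' B')"
proof -
  have "bij_betw h (carrier M) (carrier Q \<times> carrier B)" "carrier M \<noteq> {}"
    using h M by (simp_all add: algebra3_iso_def magma_iso_def algebra3_prod_def is_algebra3_def
        is_magma_def)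
  then obtain f g where f: "inj_on (f :: 'b \<Rightarrow> 'a) (carrier Q)"
    and g: "inj_on (g :: 'c \<Rightarrow> 'a) (carrier B)"
    by (rule factors_embed)
  note isos = algebra3_iso_copy[OF f] algebra3_iso_copy[OF g]
  show ?thesis
    using that[OF isos algebra3_iso_trans[OF h algebra3_iso_map_prod[OF isos]]] .
qed

lemma rectangular_quasigroupI:
  assumes M: "is_algebra3 M" and Q: "is_quasigroup Q" and B: "rectangular_band3 B"
    and h: "algebra3_iso h M (algebra3_prod Q B)"
  shows "rectangular_quasigroup M"
  using algebra3_factors[OF M h] M is_quasigroup_iso[OF _ Q] rectangular_band3_iso[OF _ B]
  unfolding rectangular_quasigroup_def by metis

lemma rectangular_loopI:
  assumes M: "is_algebra3 M" and Q: "is_loop Q" and B: "rectangular_band3 B"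
    and h: "algebra3_iso h M (algebra3_prod Q B)"
  shows "rectangular_loop M"
  using algebra3_factors[OF M h] M is_loop_iso[OF _ Q] rectangular_band3_iso[OF _ B]
  unfolding rectangular_loop_def by metis

instance trm :: countable
  by countable_datatype

lemma eval_trm_closed:
  assumes "is_algebra3 M" "\<forall>i. v i \<in> carrier M"
  shows "eval_trm M v t \<in> carrier M"
  using assms by (induction t) (auto simp: is_algebra3_def is_magma_def)

lemma eval_trm_iso:
  assumes "algebra3_iso h M N" "is_algebra3 M" "\<forall>i. v i \<in> carrier M"
  shows "eval_trm N (h \<circ> v) t = h (eval_trm M v t)"
  using assms eval_trm_closed[OF assms(2,3)]
  by (induction t) (simp_all add: algebra3_iso_def magma_iso_def)

lemma satisfies_iso:
  assumes h: "algebra3_iso h M N" and M: "is_algebra3 M"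
  shows "N \<^bold>\<Turnstile> e \<longleftrightarrow> M \<^bold>\<Turnstile> e"
proof (cases e)
  case (Equation s t)
  have bij: "bij_betw h (carrier M) (carrier N)"
    using h by (simp add: algebra3_iso_def magma_iso_def)
  have "(eval_trm N w s = eval_trm N w t) \<longleftrightarrow> (eval_trm M v s = eval_trm M v t)"
    if "w = h \<circ> v" "\<forall>i. v i \<in> carrier M" for v w
    using bij eval_trm_closed[OF M that(2)] eval_trm_iso[OF h M that(2)] that(1)
    by (auto simp: bij_betw_def inj_on_eq_iff)
  moreover have "\<exists>v. w = h \<circ> v \<and> (\<forall>i. v i \<in> carrier M)" if "\<forall>i. w i \<in> carrier N" for w
  proof (intro exI conjI)
    show "w = h \<circ> (inv_into (carrier M) h \<circ> w)"
      using bij that by (auto simp: bij_betw_def f_inv_into_f)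
    show "\<forall>i. (inv_into (carrier M) h \<circ> w) i \<in> carrier M"
      using bij that by (auto simp: bij_betw_def intro: inv_into_into)
  qed
  moreover have "\<forall>i. (h \<circ> v) i \<in> carrier N" if "\<forall>i. v i \<in> carrier M" for v
    using bij that by (auto dest: bij_betwE)
  ultimately show ?thesis
    unfolding Equation satisfies.simps by metis
qed

lemma countable_witness:
  fixes M :: "'a algebra3"
  assumes M: "is_algebra3 M" and E: "\<forall>e'\<in>E. M \<^bold>\<Turnstile> e'" and e: "\<not> M \<^bold>\<Turnstile> e"
  shows "\<exists>N :: nat algebra3. is_algebra3 N \<and> (\<forall>e'\<in>E. N \<^bold>\<Turnstile> e') \<and> \<not> N \<^bold>\<Turnstile> e"
proof -
  obtain s t where st: "e = (s \<^bold>\<approx> t)" by (cases e)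
  obtain v where v: "\<forall>i. v i \<in> carrier M" "eval_trm M v s \<noteq> eval_trm M v t"
    using e st by auto
  define S where "S = M\<lparr>carrier := range (eval_trm M v)\<rparr>"
  have eval_S: "eval_trm S w r = eval_trm M w r" for w r
    by (induction r) (simp_all add: S_def)
  have sub: "carrier S \<subseteq> carrier M"
    using eval_trm_closed[OF M v(1)] by (auto simp: S_def)
  have S: "is_algebra3 S"
    by (auto simp: S_def is_algebra3_def is_magma_def simp flip: eval_trm.simps)
  have ES: "\<forall>e'\<in>E. S \<^bold>\<Turnstile> e'"
  proof
    fix e' assume "e' \<in> E"
    with E have "M \<^bold>\<Turnstile> e'" by blast
    with sub show "S \<^bold>\<Turnstile> e'" by (cases e') (auto simp: eval_S)
  qed
  have "v i \<in> carrier S" for i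
    unfolding S_def using rangeI[of "eval_trm M v" "Var i"] by simp
  with v(2) have eS: "\<not> S \<^bold>\<Turnstile> e" by (auto simp: st eval_S)
  have "inj_on (\<lambda>x. to_nat (inv (eval_trm M v) x)) (carrier S)"
    by (rule inj_onI) (auto simp: S_def inv_into_injective)
  from algebra3_iso_copy[OF this] show ?thesis
    using is_algebra3_iso satisfies_iso S ES eS by blast
qed

text \<open>The witnesses for different equations may even live over different types: apply
  \<open>countable_witness\<close> to each of them.\<close>

lemma independent_equationsI:
  fixes W :: "equation \<Rightarrow> 'a algebra3"
  assumes "\<And>e. e \<in> E \<Longrightarrow> is_algebra3 (W e) \<and> (\<forall>e'\<in>E - {e}. W e \<^bold>\<Turnstile> e') \<and> \<not> W e \<^bold>\<Turnstile> e"
  shows "independent_equations E"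
  unfolding independent_equations_def using assms countable_witness by blast

end

theory Submission
  imports Defs
begin

text \<open>Put \<open>x \<lhd> y = x \<setminus> (x \<cdot> y)\<close> and \<open>x \<rhd> y = (x \<cdot> y) \<sslash> y\<close>.  In a product of a quasigroup, a left
  zero semigroup and a right zero semigroup, \<open>x \<lhd> y\<close> is \<open>y\<close> with its left zero coordinate replaced
  by that of \<open>x\<close>, and \<open>x \<rhd> y\<close> is \<open>x\<close> with its right zero coordinate replaced by that of \<open>y\<close>.  So
  \<open>y \<lhd> (x \<rhd> z)\<close> has the quasigroup coordinate of \<open>x\<close>, the left zero coordinate of \<open>y\<close> and the
  right zero coordinate of \<open>z\<close>.

  Completeness of the axioms means that they force \<open>\<lhd>\<close> and \<open>\<rhd>\<close> to behave in this way.  In terms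
  of them (Q1) and (Q2) say that both are idempotent, (Q3) and (Q4) that
  \<open>x \<cdot> (x \<setminus> y) = x \<lhd> y\<close> and \<open>(x \<sslash> y) \<cdot> y = x \<rhd> y\<close>, and (Q5) and (Q6) that
  \<open>(x \<setminus> y) \<lhd> (z \<cdot> u) = (x \<lhd> z) \<cdot> u\<close> and \<open>(x \<cdot> y) \<rhd> (z \<sslash> u) = x \<cdot> (y \<rhd> u)\<close>.  The derivation has
  three ingredients.  Replacing the left argument of \<open>\<lhd>\<close> by any product or quotient that begins
  with it changes nothing, so every operation is left zero in the left coordinate
  (\<open>lproj_ld_left\<close>, \<open>lproj_mul_left\<close>, \<open>lproj_rd_left\<close>).  The left coordinate of the right argument
  never matters (\<open>lproj_lproj_right\<close>, \<open>mul_lproj\<close>, \<open>ld_lproj\<close>, \<open>rd_lproj\<close>), and that of the left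
  argument passes to the result (\<open>lproj_mul\<close>, \<open>lproj_ld\<close>, \<open>lproj_rd\<close>).  Finally \<open>\<lhd>\<close> and \<open>\<rhd>\<close>
  associate with each other (\<open>lproj_rproj_assoc\<close>).  Reversing all products and exchanging the two
  divisions swaps (Q1), (Q3), (Q5) with (Q2), (Q4), (Q6), so each of these facts has a mirror image.

  With a base point \<open>a\<close>, the map \<open>x \<mapsto> (a \<lhd> (x \<rhd> a), x \<lhd> (a \<rhd> x))\<close> is then an isomorphism onto the
  product of a quasigroup and a rectangular band (\<open>decomposition\<close>).

  Equation (L) holds in every rectangular band, and in a quasigroup it says
  \<open>y \<setminus> y = x \<sslash> x\<close>, that is, that there is a two-sided identity.  Since a product satisfies an equation
  if and only if both factors do, adding (L) cuts the rectangular quasigroups down to the rectangular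
  loops.  Independence is witnessed by algebras with two or four elements and, for (L), by
  subtraction on the integers.\<close>


section \<open>The equations as identities on the carrier\<close>

lemma all_valuations2:
  "(\<forall>v. (\<forall>i. v i \<in> C) \<longrightarrow> P (v (0::nat)) (v (1::nat))) \<longleftrightarrow> (\<forall>x\<in>C. \<forall>y\<in>C. P x y)"
proof safe
  fix x y
  assume *: "\<forall>v. (\<forall>i. v i \<in> C) \<longrightarrow> P (v (0::nat)) (v (1::nat))" and "x \<in> C" "y \<in> C"
  then show "P x y"
    using *[rule_format, of "(\<lambda>_. y)(0 := x)"] by simp
qed auto

lemma all_valuations4:
  "(\<forall>v. (\<forall>i. v i \<in> C) \<longrightarrow> P (v (0::nat)) (v (1::nat)) (v (2::nat)) (v (3::nat))) \<longleftrightarrow>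
     (\<forall>x\<in>C. \<forall>y\<in>C. \<forall>z\<in>C. \<forall>u\<in>C. P x y z u)"
proof safe
  fix x y z u
  assume *: "\<forall>v. (\<forall>i. v i \<in> C) \<longrightarrow> P (v (0::nat)) (v (1::nat)) (v (2::nat)) (v (3::nat))"
    and "x \<in> C" "y \<in> C" "z \<in> C" "u \<in> C"
  then show "P x y z u"
    using *[rule_format, of "(\<lambda>_. u)(0 := x, 1 := y, 2 := z)"] by simp
qed auto

lemma satisfies_Q1: "M \<^bold>\<Turnstile> eqQ1 \<longleftrightarrow> (\<forall>x\<in>carrier M. x \<setminus>\<^bsub>M\<^esub> (x \<cdot>\<^bsub>M\<^esub> x) = x)"
  by (auto simp: eqQ1_def dest: spec[where x = "\<lambda>_. _"])

lemma satisfies_Q2: "M \<^bold>\<Turnstile> eqQ2 \<longleftrightarrow> (\<forall>x\<in>carrier M. (x \<cdot>\<^bsub>M\<^esub> x) \<sslash>\<^bsub>M\<^esub> x = x)"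
  by (auto simp: eqQ2_def dest: spec[where x = "\<lambda>_. _"])

lemma satisfies_Q3: "M \<^bold>\<Turnstile> eqQ3 \<longleftrightarrow>
    (\<forall>x\<in>carrier M. \<forall>y\<in>carrier M. x \<cdot>\<^bsub>M\<^esub> (x \<setminus>\<^bsub>M\<^esub> y) = x \<setminus>\<^bsub>M\<^esub> (x \<cdot>\<^bsub>M\<^esub> y))"
  unfolding eqQ3_def satisfies.simps eval_trm.simps by (rule all_valuations2)

lemma satisfies_Q4: "M \<^bold>\<Turnstile> eqQ4 \<longleftrightarrow>
    (\<forall>x\<in>carrier M. \<forall>y\<in>carrier M. (x \<sslash>\<^bsub>M\<^esub> y) \<cdot>\<^bsub>M\<^esub> y = (x \<cdot>\<^bsub>M\<^esub> y) \<sslash>\<^bsub>M\<^esub> y)"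
  unfolding eqQ4_def satisfies.simps eval_trm.simps by (rule all_valuations2)

lemma satisfies_Q5: "M \<^bold>\<Turnstile> eqQ5 \<longleftrightarrow>
    (\<forall>x\<in>carrier M. \<forall>y\<in>carrier M. \<forall>z\<in>carrier M. \<forall>u\<in>carrier M.
       (x \<setminus>\<^bsub>M\<^esub> y) \<setminus>\<^bsub>M\<^esub> ((x \<setminus>\<^bsub>M\<^esub> y) \<cdot>\<^bsub>M\<^esub> (z \<cdot>\<^bsub>M\<^esub> u)) = (x \<setminus>\<^bsub>M\<^esub> (x \<cdot>\<^bsub>M\<^esub> z)) \<cdot>\<^bsub>M\<^esub> u)"
  unfolding eqQ5_def satisfies.simps eval_trm.simps by (rule all_valuations4)

lemma satisfies_Q6: "M \<^bold>\<Turnstile> eqQ6 \<longleftrightarrow>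
    (\<forall>x\<in>carrier M. \<forall>y\<in>carrier M. \<forall>z\<in>carrier M. \<forall>u\<in>carrier M.
       ((x \<cdot>\<^bsub>M\<^esub> y) \<cdot>\<^bsub>M\<^esub> (z \<sslash>\<^bsub>M\<^esub> u)) \<sslash>\<^bsub>M\<^esub> (z \<sslash>\<^bsub>M\<^esub> u) = x \<cdot>\<^bsub>M\<^esub> ((y \<cdot>\<^bsub>M\<^esub> u) \<sslash>\<^bsub>M\<^esub> u))"
  unfolding eqQ6_def satisfies.simps eval_trm.simps by (rule all_valuations4)

lemma satisfies_L: "M \<^bold>\<Turnstile> eqL \<longleftrightarrow>
    (\<forall>x\<in>carrier M. \<forall>y\<in>carrier M.
       x \<setminus>\<^bsub>M\<^esub> (x \<cdot>\<^bsub>M\<^esub> (y \<setminus>\<^bsub>M\<^esub> y)) = ((x \<sslash>\<^bsub>M\<^esub> x) \<cdot>\<^bsub>M\<^esub> y) \<sslash>\<^bsub>M\<^esub> y)"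
  unfolding eqL_def satisfies.simps eval_trm.simps by (rule all_valuations2)

lemmas satisfies_iffs =
  satisfies_Q1 satisfies_Q2 satisfies_Q3 satisfies_Q4 satisfies_Q5 satisfies_Q6 satisfies_L

abbreviation rectangular_axioms :: "equation set" where
  "rectangular_axioms \<equiv> {eqQ1, eqQ2, eqQ3, eqQ4, eqQ5, eqQ6}"


section \<open>Equations in products, quasigroups, loops and bands\<close>

lemma eval_trm_prod:
  "eval_trm (algebra3_prod M N) v t = (eval_trm M (fst \<circ> v) t, eval_trm N (snd \<circ> v) t)"
  by (induction t) (simp_all add: algebra3_prod_def)

lemma satisfies_prod:
  assumes "carrier M \<noteq> {}" "carrier N \<noteq> {}"
  shows "algebra3_prod M N \<^bold>\<Turnstile> e \<longleftrightarrow> M \<^bold>\<Turnstile> e \<and> N \<^bold>\<Turnstile> e"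
proof (cases e)
  case (Equation s t)
  obtain a b where ab: "a \<in> carrier M" "b \<in> carrier N" using assms by auto
  have carrier: "carrier (algebra3_prod M N) = carrier M \<times> carrier N"
    by (simp add: algebra3_prod_def)
  have "M \<^bold>\<Turnstile> e \<and> N \<^bold>\<Turnstile> e" if *: "algebra3_prod M N \<^bold>\<Turnstile> e"
  proof -
    have **: "eval_trm M (fst \<circ> v) s = eval_trm M (fst \<circ> v) t \<and>
        eval_trm N (snd \<circ> v) s = eval_trm N (snd \<circ> v) t"
      if "\<forall>i. v i \<in> carrier M \<times> carrier N" for v :: "nat \<Rightarrow> _"
      using * that unfolding Equation by (simp add: eval_trm_prod carrier)
    show ?thesis
      unfolding Equation satisfies.simps
    proof safe
      fix v :: "nat \<Rightarrow> _" assume "\<forall>i. v i \<in> carrier M"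
      then show "eval_trm M v s = eval_trm M v t"
        using **[of "\<lambda>i. (v i, b)"] ab by (simp add: comp_def)
    next
      fix v :: "nat \<Rightarrow> _" assume "\<forall>i. v i \<in> carrier N"
      then show "eval_trm N v s = eval_trm N v t"
        using **[of "\<lambda>i. (a, v i)"] ab by (simp add: comp_def)
    qed
  qed
  moreover have "algebra3_prod M N \<^bold>\<Turnstile> e" if "M \<^bold>\<Turnstile> e" "N \<^bold>\<Turnstile> e"
    using that unfolding Equation by (simp add: eval_trm_prod carrier mem_Times_iff)
  ultimately show ?thesis by blast
qed

lemma quasigroup_satisfies:
  assumes "is_quasigroup Q" "e \<in> rectangular_axioms"
  shows "Q \<^bold>\<Turnstile> e"
  using assms
  by (auto simp: is_quasigroup_def is_algebra3_def is_magma_def satisfies_iffs)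

text \<open>Cancellation in (L) leaves \<open>y \<setminus> y = x \<sslash> x\<close> for all \<open>x\<close>, \<open>y\<close>; their common value is the
  identity element.\<close>

lemma loop_iff_quasigroup_satisfies_L: "is_loop Q \<longleftrightarrow> is_quasigroup Q \<and> Q \<^bold>\<Turnstile> eqL"
proof safe
  assume Q: "is_loop Q"
  then show "is_quasigroup Q" by (simp add: is_loop_def)
  then have closed: "x \<setminus>\<^bsub>Q\<^esub> y \<in> carrier Q" "x \<sslash>\<^bsub>Q\<^esub> y \<in> carrier Q"
    and cancel: "x \<setminus>\<^bsub>Q\<^esub> (x \<cdot>\<^bsub>Q\<^esub> y) = y" "(x \<cdot>\<^bsub>Q\<^esub> y) \<sslash>\<^bsub>Q\<^esub> y = x"
    if "x \<in> carrier Q" "y \<in> carrier Q" for x y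
    using that by (auto simp: is_quasigroup_def is_algebra3_def)
  obtain e where e: "e \<in> carrier Q" "\<And>x. x \<in> carrier Q \<Longrightarrow> e \<cdot>\<^bsub>Q\<^esub> x = x \<and> x \<cdot>\<^bsub>Q\<^esub> e = x"
    using Q by (auto simp: is_loop_def)
  have "x \<setminus>\<^bsub>Q\<^esub> x = e" "x \<sslash>\<^bsub>Q\<^esub> x = e" if "x \<in> carrier Q" for x
    using cancel(1)[OF that e(1)] cancel(2)[OF e(1) that] e(2)[OF that] by simp_all
  then show "Q \<^bold>\<Turnstile> eqL"
    by (simp add: satisfies_L cancel closed e)
next
  assume Q: "is_quasigroup Q" and L: "Q \<^bold>\<Turnstile> eqL"
  then have A: "is_algebra3 Q" by (simp add: is_quasigroup_def)
  then obtain a where a: "a \<in> carrier Q" by (auto simp: is_algebra3_def is_magma_def)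
  have eq: "y \<setminus>\<^bsub>Q\<^esub> y = x \<sslash>\<^bsub>Q\<^esub> x" if "x \<in> carrier Q" "y \<in> carrier Q" for x y
    using L Q A that by (simp add: satisfies_L is_quasigroup_def is_algebra3_def)
  show "is_loop Q"
    unfolding is_loop_def
  proof (intro conjI bexI[of _ "a \<sslash>\<^bsub>Q\<^esub> a"] ballI)
    fix x assume x: "x \<in> carrier Q"
    have "a \<sslash>\<^bsub>Q\<^esub> a = x \<sslash>\<^bsub>Q\<^esub> x"
      using eq[OF a x] eq[OF x x] by simp
    then show "(a \<sslash>\<^bsub>Q\<^esub> a) \<cdot>\<^bsub>Q\<^esub> x = x"
      using Q x by (simp add: is_quasigroup_def)
    show "x \<cdot>\<^bsub>Q\<^esub> (a \<sslash>\<^bsub>Q\<^esub> a) = x"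
      using Q x unfolding eq[OF a x, symmetric] by (simp add: is_quasigroup_def)
  qed (use Q A a in \<open>simp_all add: is_algebra3_def\<close>)
qed

text \<open>The divisions are products here, and in coordinates a product keeps the left entry of
  the first factor and the right entry of the last, so both sides of each axiom need only begin with
  the same variable and end with the same variable.\<close>

lemma rectangular_band3_satisfies:
  assumes B: "rectangular_band3 B" and e: "e \<in> insert eqL rectangular_axioms"
  shows "B \<^bold>\<Turnstile> e"
proof -
  have closed: "x \<cdot>\<^bsub>B\<^esub> y \<in> carrier B" if "x \<in> carrier B" "y \<in> carrier B" for x y
    using B that by (simp add: rectangular_band3_def is_algebra3_def is_magma_def)
  obtain L R :: "'a magma" and h where L: "left_zero_semigroup L"
    and R: "right_zero_semigroup R" and h: "magma_iso h B (magma_prod L R)"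
    using B by (auto simp: rectangular_band3_def rectangular_band_def)
  have inj: "inj_on h (carrier B)"
    using h by (simp add: magma_iso_def bij_betw_def)
  have hom: "h (x \<cdot>\<^bsub>B\<^esub> y) = (fst (h x) \<cdot>\<^bsub>L\<^esub> fst (h y), snd (h x) \<cdot>\<^bsub>R\<^esub> snd (h y))"
      if "x \<in> carrier B" "y \<in> carrier B" for x y
    using h that by (simp_all add: magma_iso_def magma_prod_def bij_betw_def)
  have into: "h x \<in> carrier L \<times> carrier R" if "x \<in> carrier B" for x
    using h that by (auto simp: magma_iso_def magma_prod_def dest: bij_betwE)
  have h_mul: "h (x \<cdot>\<^bsub>B\<^esub> y) = (fst (h x), snd (h y))" if "x \<in> carrier B" "y \<in> carrier B" for x y
    using into[OF that(1)] into[OF that(2)] hom[OF that] L R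
    by (auto simp: left_zero_semigroup_def right_zero_semigroup_def)
  have band: "x \<cdot>\<^bsub>B\<^esub> x = x" "(x \<cdot>\<^bsub>B\<^esub> y) \<cdot>\<^bsub>B\<^esub> z = x \<cdot>\<^bsub>B\<^esub> z" "x \<cdot>\<^bsub>B\<^esub> (y \<cdot>\<^bsub>B\<^esub> z) = x \<cdot>\<^bsub>B\<^esub> z"
    if "x \<in> carrier B" "y \<in> carrier B" "z \<in> carrier B" for x y z
    by (simp_all add: inj_onD[OF inj] h_mul closed that)
  have "x \<setminus>\<^bsub>B\<^esub> y = x \<cdot>\<^bsub>B\<^esub> y" "x \<sslash>\<^bsub>B\<^esub> y = x \<cdot>\<^bsub>B\<^esub> y" if "x \<in> carrier B" "y \<in> carrier B" for x y
    using B that by (simp_all add: rectangular_band3_def)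
  then show ?thesis
    using e by (elim insertE emptyE) (simp_all add: satisfies_iffs closed band)
qed

lemma rectangular_quasigroup_satisfies:
  assumes M: "rectangular_quasigroup M" and e: "e \<in> rectangular_axioms"
  shows "M \<^bold>\<Turnstile> e"
proof -
  obtain Q B :: "'a algebra3" and h where A: "is_algebra3 M" and Q: "is_quasigroup Q"
    and B: "rectangular_band3 B" and h: "algebra3_iso h M (algebra3_prod Q B)"
    using M by (auto simp: rectangular_quasigroup_def)
  have "carrier Q \<noteq> {}" "carrier B \<noteq> {}"
    using Q B by (auto simp: is_quasigroup_def rectangular_band3_def is_algebra3_def is_magma_def)
  then show ?thesis
    using quasigroup_satisfies[OF Q e] rectangular_band3_satisfies[OF B] e
    by (simp add: satisfies_iso[OF h A, symmetric] satisfies_prod)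
qed

lemma rectangular_loop_iff: "rectangular_loop M \<longleftrightarrow> rectangular_quasigroup M \<and> M \<^bold>\<Turnstile> eqL"
proof -
  have "is_loop Q \<longleftrightarrow> is_quasigroup Q \<and> M \<^bold>\<Turnstile> eqL"
    if A: "is_algebra3 M" and B: "rectangular_band3 B"
      and h: "algebra3_iso h M (algebra3_prod Q B)" for Q B :: "'a algebra3" and h
  proof -
    have "M \<^bold>\<Turnstile> eqL \<longleftrightarrow> Q \<^bold>\<Turnstile> eqL" if "is_quasigroup Q"
    proof -
      have "carrier Q \<noteq> {}" "carrier B \<noteq> {}"
        using that B
        by (auto simp: is_quasigroup_def rectangular_band3_def is_algebra3_def is_magma_def)
      then show ?thesis
        using rectangular_band3_satisfies[OF B]
        by (simp add: satisfies_iso[OF h A, symmetric] satisfies_prod)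
    qed
    then show ?thesis
      using loop_iff_quasigroup_satisfies_L by blast
  qed
  then show ?thesis
    unfolding rectangular_loop_def rectangular_quasigroup_def by blast
qed


section \<open>Two projections\<close>

text \<open>The divisions \<open>x \<setminus> y\<close> and \<open>x \<sslash> y\<close> are written \<open>x \<rightharpoonup> y\<close> and \<open>x \<leftharpoonup> y\<close>.  Bare functions in place of
  a record, and the two projections as parameters in place of abbreviations, make the locale
  literally invariant under the mirror symmetry, which is then available as a sublocale.\<close>

locale rectangular_identities =
  fixes C :: "'a set"
    and mul :: "'a \<Rightarrow> 'a \<Rightarrow> 'a" (infixl \<open>\<odot>\<close> 70)
    and ld :: "'a \<Rightarrow> 'a \<Rightarrow> 'a" (infixl \<open>\<rightharpoonup>\<close> 70)
    and rd :: "'a \<Rightarrow> 'a \<Rightarrow> 'a" (infixl \<open>\<leftharpoonup>\<close> 70)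
    and lproj :: "'a \<Rightarrow> 'a \<Rightarrow> 'a" (infixl \<open>\<lhd>\<close> 65)
    and rproj :: "'a \<Rightarrow> 'a \<Rightarrow> 'a" (infixl \<open>\<rhd>\<close> 65)
  assumes mul_closed [simp]: "x \<in> C \<Longrightarrow> y \<in> C \<Longrightarrow> x \<odot> y \<in> C"
    and ld_closed [simp]: "x \<in> C \<Longrightarrow> y \<in> C \<Longrightarrow> x \<rightharpoonup> y \<in> C"
    and rd_closed [simp]: "x \<in> C \<Longrightarrow> y \<in> C \<Longrightarrow> x \<leftharpoonup> y \<in> C"
    and lproj_def: "x \<lhd> y = x \<rightharpoonup> (x \<odot> y)"
    and rproj_def: "x \<rhd> y = (x \<odot> y) \<leftharpoonup> y"
    and lproj_idem [simp]: "x \<in> C \<Longrightarrow> x \<lhd> x = x"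
    and rproj_idem [simp]: "x \<in> C \<Longrightarrow> x \<rhd> x = x"
    and mul_ld [simp]: "x \<in> C \<Longrightarrow> y \<in> C \<Longrightarrow> x \<odot> (x \<rightharpoonup> y) = x \<lhd> y"
    and rd_mul [simp]: "x \<in> C \<Longrightarrow> y \<in> C \<Longrightarrow> (x \<leftharpoonup> y) \<odot> y = x \<rhd> y"
    and Q5: "\<lbrakk>x \<in> C; y \<in> C; z \<in> C; u \<in> C\<rbrakk> \<Longrightarrow> (x \<rightharpoonup> y) \<lhd> (z \<odot> u) = (x \<lhd> z) \<odot> u"
    and Q6: "\<lbrakk>x \<in> C; y \<in> C; z \<in> C; u \<in> C\<rbrakk> \<Longrightarrow> (x \<odot> y) \<rhd> (z \<leftharpoonup> u) = x \<odot> (y \<rhd> u)"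

sublocale rectangular_identities \<subseteq>
  mirror: rectangular_identities C "\<lambda>x y. y \<odot> x" "\<lambda>x y. y \<leftharpoonup> x" "\<lambda>x y. y \<rightharpoonup> x"
    "\<lambda>x y. y \<rhd> x" "\<lambda>x y. y \<lhd> x"
  by unfold_locales (simp_all add: lproj_def[symmetric] rproj_def[symmetric] Q5 Q6)

context rectangular_identities
begin

lemma lproj_closed [simp]: "x \<in> C \<Longrightarrow> y \<in> C \<Longrightarrow> x \<lhd> y \<in> C"
  by (simp add: lproj_def)

lemma rproj_closed [simp]: "x \<in> C \<Longrightarrow> y \<in> C \<Longrightarrow> x \<rhd> y \<in> C"
  by (simp add: rproj_def)

text \<open>(Q5) with \<open>y = x \<odot> x\<close>, for which \<open>x \<rightharpoonup> y = x\<close> by idempotence.\<close>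

lemma lproj_mul [simp]:
  assumes "x \<in> C" "y \<in> C" "z \<in> C"
  shows "(x \<lhd> y) \<odot> z = x \<lhd> y \<odot> z"
  using Q5[of x "x \<odot> x" y z] lproj_idem[of x] assms by (simp add: lproj_def)

text \<open>(Q5) and the previous identity give this when \<open>z\<close> is a product, and every element is one,
  since \<open>(z \<leftharpoonup> z) \<odot> z = z \<rhd> z = z\<close>.\<close>

lemma lproj_ld_left [simp]:
  assumes "x \<in> C" "y \<in> C" "z \<in> C"
  shows "(x \<rightharpoonup> y) \<lhd> z = x \<lhd> z"
proof -
  have "(z \<leftharpoonup> z) \<odot> z = z"
    using assms by simp
  then show ?thesis
    using Q5[of x y "z \<leftharpoonup> z" z] lproj_mul[of x "z \<leftharpoonup> z" z] assms by simp
qed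

lemma mul_lproj_self:
  assumes "x \<in> C" "y \<in> C"
  shows "x \<odot> (x \<lhd> y) = x \<odot> y"
proof -
  have "x \<odot> (x \<lhd> y) = x \<lhd> x \<odot> y"
    using mul_ld[of x "x \<odot> y"] assms by (simp add: lproj_def)
  then show ?thesis
    using lproj_mul[of x x y] assms by simp
qed

lemma lproj_lproj_left [simp]:
  assumes "x \<in> C" "y \<in> C" "z \<in> C"
  shows "(x \<lhd> y) \<lhd> z = x \<lhd> z"
  using lproj_ld_left[of x "x \<odot> y" z] assms by (simp add: lproj_def)

lemma lproj_mul_left [simp]:
  assumes "x \<in> C" "y \<in> C" "z \<in> C"
  shows "(x \<odot> y) \<lhd> z = x \<lhd> z"
proof -
  have "x \<odot> y = x \<lhd> x \<odot> y"
    using lproj_mul[of x x y] assms by simp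
  then show ?thesis
    using lproj_lproj_left[of x "x \<odot> y" z] assms by simp
qed

text \<open>Unfolding \<open>\<lhd>\<close> in \<open>x \<lhd> w = (x \<lhd> y) \<lhd> w\<close> gives \<open>x \<lhd> w = (x \<lhd> y) \<rightharpoonup> (x \<lhd> y \<odot> w)\<close>.
  Thus \<open>x \<lhd> w\<close> depends on \<open>w\<close> only through \<open>y \<odot> w\<close>, and \<open>y \<odot> (y \<lhd> z) = y \<odot> z\<close>.\<close>

lemma lproj_lproj_right [simp]:
  assumes "x \<in> C" "y \<in> C" "z \<in> C"
  shows "x \<lhd> (y \<lhd> z) = x \<lhd> z"
proof -
  have "x \<lhd> w = (x \<lhd> y) \<rightharpoonup> (x \<lhd> y \<odot> w)" if "w \<in> C" for w
    using lproj_lproj_left[of x y w] lproj_mul[of x y w] assms that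
    by (simp add: lproj_def[of "x \<lhd> y"])
  from this[of "y \<lhd> z"] this[of z] show ?thesis
    using mul_lproj_self[of y z] assms by simp
qed

lemma mul_lproj [simp]:
  assumes "x \<in> C" "y \<in> C" "z \<in> C"
  shows "x \<odot> (y \<lhd> z) = x \<odot> z"
  using mul_lproj_self[of x "y \<lhd> z"] mul_lproj_self[of x z] assms by simp

end

\<comment> \<open>Reopened, so that the mirror images of the preceding lemmas become available.\<close>
context rectangular_identities
begin

text \<open>Products do not change the left coordinate of their first factor, and
  \<open>(x \<rhd> y) \<odot> y = x \<odot> y\<close> by the mirror image of \<open>mul_lproj_self\<close>.\<close>

lemma lproj_rproj_left [simp]:
  assumes "x \<in> C" "y \<in> C" "z \<in> C"
  shows "(x \<rhd> y) \<lhd> z = x \<lhd> z"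
  using lproj_mul_left[of "x \<rhd> y" y z] lproj_mul_left[of x y z] assms by simp

lemma lproj_rd_left [simp]:
  assumes "x \<in> C" "y \<in> C" "z \<in> C"
  shows "(x \<leftharpoonup> y) \<lhd> z = x \<lhd> z"
  using lproj_mul_left[of "x \<leftharpoonup> y" y z] assms by simp

end

context rectangular_identities
begin

text \<open>Both sides have the same product with \<open>z\<close> on the right, and \<open>w = x \<lhd> (y \<rhd> z)\<close> is recovered
  from \<open>w \<odot> z\<close> as \<open>w \<rhd> z = w\<close>, because \<open>w\<close> and \<open>z\<close> agree in the right coordinate.  This is its own
  mirror image read backwards, so as a default rewrite rule it would loop.\<close>

lemma lproj_rproj_assoc:
  assumes "x \<in> C" "y \<in> C" "z \<in> C"
  shows "(x \<lhd> y) \<rhd> z = x \<lhd> (y \<rhd> z)"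
proof -
  define w where "w = x \<lhd> (y \<rhd> z)"
  have w: "w \<in> C"
    using assms by (simp add: w_def)
  have "(x \<lhd> y) \<rhd> z = (x \<lhd> y \<odot> z) \<leftharpoonup> z"
    using assms by (simp add: rproj_def[of "x \<lhd> y"])
  also have "\<dots> = (w \<odot> z) \<leftharpoonup> z"
    using assms by (simp add: w_def)
  also have "\<dots> = w \<rhd> z"
    by (simp add: rproj_def)
  also have "\<dots> = w \<rhd> (x \<lhd> (y \<rhd> z))"
    using assms w by simp
  also have "\<dots> = w"
    using w by (simp flip: w_def)
  finally show ?thesis
    by (simp add: w_def)
qed

lemma lproj_ld_right:
  assumes "x \<in> C" "y \<in> C"
  shows "x \<lhd> (x \<rightharpoonup> y) = x \<rightharpoonup> y"
  using lproj_ld_left[of x y "x \<rightharpoonup> y"] assms by simp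

lemma ld_lproj_self:
  assumes "x \<in> C" "y \<in> C"
  shows "x \<rightharpoonup> (x \<lhd> y) = x \<rightharpoonup> y"
  using lproj_ld_right[of x y] assms by (simp add: lproj_def[of x "x \<rightharpoonup> y"])

lemma ld_lproj [simp]:
  assumes "x \<in> C" "y \<in> C" "z \<in> C"
  shows "x \<rightharpoonup> (y \<lhd> z) = x \<rightharpoonup> z"
  using ld_lproj_self[of x "y \<lhd> z"] ld_lproj_self[of x z] assms by simp

text \<open>Let \<open>p = x \<lhd> y\<close> and \<open>r = p \<rightharpoonup> z\<close>.  Since \<open>y \<lhd> p = y\<close>, the product \<open>y \<odot> r = y \<lhd> p \<odot> r\<close> equals
  \<open>y \<lhd> z\<close>, and dividing by \<open>y\<close> gives \<open>y \<lhd> r = y \<rightharpoonup> z\<close>.  Now \<open>x \<lhd> _\<close> turns the left-hand side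
  into \<open>x \<lhd> r = r\<close>.\<close>

lemma lproj_ld [simp]:
  assumes "x \<in> C" "y \<in> C" "z \<in> C"
  shows "(x \<lhd> y) \<rightharpoonup> z = x \<lhd> (y \<rightharpoonup> z)"
proof -
  define p where "p = x \<lhd> y"
  have p: "p \<in> C" using assms by (simp add: p_def)
  have yp: "y \<lhd> p = y"
    using assms by (simp add: p_def)
  have "y \<odot> (p \<rightharpoonup> z) = (y \<lhd> p) \<odot> (p \<rightharpoonup> z)"
    by (simp add: yp)
  also have "\<dots> = y \<lhd> z"
    using assms p by simp
  finally have "y \<lhd> (p \<rightharpoonup> z) = y \<rightharpoonup> z"
    using assms p by (simp add: lproj_def[of y "p \<rightharpoonup> z"])
  then have "x \<lhd> (y \<rightharpoonup> z) = x \<lhd> (p \<rightharpoonup> z)"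
    using lproj_lproj_right[of x y "p \<rightharpoonup> z"] assms p by simp
  also have "\<dots> = p \<lhd> (p \<rightharpoonup> z)"
    using assms p by (simp add: p_def)
  also have "\<dots> = p \<rightharpoonup> z"
    using assms p by (simp add: lproj_ld_right)
  finally show ?thesis by (simp add: p_def)
qed

end

context rectangular_identities
begin

text \<open>Quotients \<open>x \<leftharpoonup> y\<close> satisfy \<open>(x \<leftharpoonup> y) \<rhd> y = x \<leftharpoonup> y\<close>, so equality of two of them can be tested
  after multiplication by \<open>y\<close>.\<close>

lemma rproj_fixed_cancel:
  assumes "a \<in> C" "b \<in> C" "y \<in> C" "a \<rhd> y = a" "b \<rhd> y = b" "a \<odot> y = b \<odot> y"
  shows "a = b"
  using assms by (metis rproj_def)

lemma lproj_rd [simp]: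
  assumes "x \<in> C" "y \<in> C" "z \<in> C"
  shows "(x \<lhd> y) \<leftharpoonup> z = x \<lhd> (y \<leftharpoonup> z)"
proof (rule rproj_fixed_cancel)
  show "((x \<lhd> y) \<leftharpoonup> z) \<rhd> z = (x \<lhd> y) \<leftharpoonup> z"
    using mirror.lproj_ld_right assms by simp
  show "(x \<lhd> (y \<leftharpoonup> z)) \<rhd> z = x \<lhd> (y \<leftharpoonup> z)"
    using mirror.lproj_ld_right assms by (simp add: lproj_rproj_assoc)
qed (use assms in \<open>simp_all add: lproj_rproj_assoc\<close>)

lemma rd_lproj [simp]:
  assumes "x \<in> C" "y \<in> C" "z \<in> C"
  shows "x \<leftharpoonup> (y \<lhd> z) = x \<leftharpoonup> z"
proof (rule rproj_fixed_cancel)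
  show "(x \<leftharpoonup> (y \<lhd> z)) \<rhd> z = x \<leftharpoonup> (y \<lhd> z)"
    using mirror.lproj_ld_right[of "y \<lhd> z" x] assms by simp
  show "(x \<leftharpoonup> z) \<rhd> z = x \<leftharpoonup> z"
    using mirror.lproj_ld_right assms by simp
  have "(x \<leftharpoonup> (y \<lhd> z)) \<odot> z = (x \<leftharpoonup> (y \<lhd> z)) \<odot> (y \<lhd> z)"
    using mul_lproj[of "x \<leftharpoonup> (y \<lhd> z)" y z] assms by simp
  then show "(x \<leftharpoonup> (y \<lhd> z)) \<odot> z = (x \<leftharpoonup> z) \<odot> z"
    using assms by (simp del: mul_lproj)
qed (use assms in simp_all)

end


section \<open>The decomposition\<close>

context rectangular_identities
begin

lemma cancel [simp]: "x \<rightharpoonup> (x \<odot> y) = x \<lhd> y" "(x \<odot> y) \<leftharpoonup> y = x \<rhd> y"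
  by (simp_all add: lproj_def rproj_def)

lemma lproj_rproj_same [simp]:
  assumes "x \<in> C" "y \<in> C" "z \<in> C"
  shows "x \<lhd> (x \<rhd> y) = x \<rhd> y"
  using lproj_rproj_assoc[of x x y] assms by simp

text \<open>Relative to the base point \<open>a\<close>, each part keeps some coordinates and resets the others to those
  of \<open>a\<close>.  As \<open>a\<close> need not be idempotent, the range of such a part need not be closed under the
  operations; those of the factors therefore project back.  On the range of \<open>band_part a\<close> all three
  operations project back to \<open>\<lhd>\<close>.\<close>

definition quasigroup_part :: "'a \<Rightarrow> 'a \<Rightarrow> 'a" where
  "quasigroup_part a x = a \<lhd> (x \<rhd> a)"

definition band_part :: "'a \<Rightarrow> 'a \<Rightarrow> 'a" where
  "band_part a x = x \<lhd> (a \<rhd> x)"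

definition quasigroup_factor :: "'a \<Rightarrow> 'a algebra3" where
  "quasigroup_factor a = \<lparr> carrier = quasigroup_part a ` C,
     mul = (\<lambda>x y. quasigroup_part a (x \<odot> y)),
     ldiv = (\<lambda>x y. quasigroup_part a (x \<rightharpoonup> y)),
     rdiv = (\<lambda>x y. quasigroup_part a (x \<leftharpoonup> y)) \<rparr>"

definition band_factor :: "'a \<Rightarrow> 'a algebra3" where
  "band_factor a = \<lparr> carrier = band_part a ` C, mul = (\<lhd>), ldiv = (\<lhd>), rdiv = (\<lhd>) \<rparr>"

lemma is_quasigroup_quasigroup_factor:
  assumes "a \<in> C"
  shows "is_quasigroup (quasigroup_factor a)"
  using assms
  by (auto simp: is_quasigroup_def is_algebra3_def is_magma_def quasigroup_factor_def
      quasigroup_part_def lproj_rproj_assoc)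

lemma rectangular_band3_band_factor:
  assumes a: "a \<in> C"
  shows "rectangular_band3 (band_factor a)"
proof -
  let ?L = "\<lparr> carrier = (\<lambda>x. x \<lhd> a) ` C, mul = (\<lambda>x y. x) \<rparr> :: 'a magma"
  let ?R = "\<lparr> carrier = (\<lambda>x. a \<rhd> x) ` C, mul = (\<lambda>x y. y) \<rparr> :: 'a magma"
  have image: "x \<lhd> (a \<rhd> y) \<in> band_part a ` C" if "x \<in> C" "y \<in> C" for x y
    by (rule image_eqI[where x = "x \<lhd> (a \<rhd> y)"])
      (use a that in \<open>simp_all add: band_part_def lproj_rproj_assoc\<close>)
  then have alg: "is_algebra3 (band_factor a)" and semi: "is_semigroup (band_factor a)"
    using a by (auto simp: is_algebra3_def is_semigroup_def is_magma_def band_factor_def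
        band_part_def lproj_rproj_assoc)
  have L: "left_zero_semigroup ?L" and R: "right_zero_semigroup ?R"
    using a by (auto simp: left_zero_semigroup_def right_zero_semigroup_def is_semigroup_def
        is_magma_def)
  have iso: "magma_iso (\<lambda>x. (x \<lhd> a, a \<rhd> x)) (band_factor a) (magma_prod ?L ?R)"
    unfolding magma_iso_def
  proof
    show "bij_betw (\<lambda>x. (x \<lhd> a, a \<rhd> x)) (carrier (band_factor a)) (carrier (magma_prod ?L ?R))"
    proof (rule bij_betw_byWitness[where f' = "\<lambda>(l, r). l \<lhd> r"])
      show "(\<lambda>(l, r). l \<lhd> r) ` carrier (magma_prod ?L ?R) \<subseteq> carrier (band_factor a)"
        using a image by (auto simp: band_factor_def magma_prod_def)
    qed (use a in \<open>auto simp: band_factor_def magma_prod_def band_part_def lproj_rproj_assoc\<close>)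
  qed (use a in \<open>auto simp: band_factor_def magma_prod_def band_part_def lproj_rproj_assoc\<close>)
  show ?thesis
    using alg rectangular_bandI[OF semi L R iso] by (simp add: rectangular_band3_def band_factor_def)
qed

text \<open>The inverse map \<open>(q, b) \<mapsto> b \<lhd> (q \<rhd> b)\<close> takes the quasigroup coordinate of \<open>q\<close> and the two
  zero coordinates of \<open>b\<close>.\<close>

lemma decomposition:
  assumes a: "a \<in> C"
  shows "algebra3_iso (\<lambda>x. (quasigroup_part a x, band_part a x))
     \<lparr> carrier = C, mul = (\<odot>), ldiv = (\<rightharpoonup>), rdiv = (\<leftharpoonup>) \<rparr>
     (algebra3_prod (quasigroup_factor a) (band_factor a))"
    (is "algebra3_iso ?h ?M ?P")
proof -
  have "bij_betw ?h (carrier ?M) (carrier ?P)"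
    by (rule bij_betw_byWitness[where f' = "\<lambda>(q, b). b \<lhd> (q \<rhd> b)"])
      (use a in \<open>auto simp: quasigroup_factor_def band_factor_def algebra3_prod_def
        quasigroup_part_def band_part_def lproj_rproj_assoc\<close>)
  then show ?thesis
    using a by (auto simp: algebra3_iso_def magma_iso_def quasigroup_factor_def band_factor_def
        algebra3_prod_def quasigroup_part_def band_part_def lproj_rproj_assoc)
qed

end

lemma rectangular_quasigroup_of_axioms:
  assumes M: "is_algebra3 M" and sat: "\<forall>e\<in>rectangular_axioms. M \<^bold>\<Turnstile> e"
  shows "rectangular_quasigroup M"
proof -
  have identities: "rectangular_identities (carrier M) (mul M) (ldiv M) (rdiv M)
    (\<lambda>x y. x \<setminus>\<^bsub>M\<^esub> (x \<cdot>\<^bsub>M\<^esub> y)) (\<lambda>x y. (x \<cdot>\<^bsub>M\<^esub> y) \<sslash>\<^bsub>M\<^esub> y)"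
    using M sat by unfold_locales (simp_all add: is_algebra3_def is_magma_def satisfies_iffs)
  obtain a where a: "a \<in> carrier M"
    using M by (auto simp: is_algebra3_def is_magma_def)
  have M_eq: "\<lparr> carrier = carrier M, mul = mul M, ldiv = ldiv M, rdiv = rdiv M \<rparr> = M"
    by simp
  show ?thesis
    by (rule rectangular_quasigroupI[OF M
          rectangular_identities.is_quasigroup_quasigroup_factor[OF identities a]
          rectangular_identities.rectangular_band3_band_factor[OF identities a]
          rectangular_identities.decomposition[OF identities a, unfolded M_eq]])
qed


section \<open>Independence\<close>

lemma independent_equations_subset:
  assumes "independent_equations F" "E \<subseteq> F"
  shows "independent_equations E"
  using assms unfolding independent_equations_def by blast

definition on_type :: "('a \<Rightarrow> 'a \<Rightarrow> 'a) \<Rightarrow> ('a \<Rightarrow> 'a \<Rightarrow> 'a) \<Rightarrow> ('a \<Rightarrow> 'a \<Rightarrow> 'a) \<Rightarrow> 'a algebra3" where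
  "on_type m l r = \<lparr> carrier = UNIV, mul = m, ldiv = l, rdiv = r \<rparr>"

lemma on_type_simps [simp]:
  "carrier (on_type m l r) = UNIV" "mul (on_type m l r) = m"
  "ldiv (on_type m l r) = l" "rdiv (on_type m l r) = r" "is_algebra3 (on_type m l r)"
  by (simp_all add: on_type_def is_algebra3_def is_magma_def)

lemma independent_rectangular_loop_axioms:
  "independent_equations (insert eqL rectangular_axioms)" (is "independent_equations ?E")
  unfolding independent_equations_def
proof
  fix e assume "e \<in> ?E"
  then consider "e = eqQ1" | "e = eqQ2" | "e = eqQ3" | "e = eqQ4" | "e = eqQ5" | "e = eqQ6"
    | "e = eqL" by blast
  then show "\<exists>N :: nat algebra3. is_algebra3 N \<and> (\<forall>e'\<in>?E - {e}. N \<^bold>\<Turnstile> e') \<and> \<not> N \<^bold>\<Turnstile> e"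
  proof cases
    \<comment> \<open>Addition modulo 2, with 1 added to every left quotient.\<close>
    case 1
    show ?thesis
      unfolding 1 by (rule countable_witness[of "on_type (\<noteq>) (=) ((\<noteq>) :: bool \<Rightarrow> _)"])
        (auto simp: satisfies_iffs)
  next
    \<comment> \<open>The mirror image of the previous algebra.\<close>
    case 2
    show ?thesis
      unfolding 2 by (rule countable_witness[of "on_type (\<noteq>) (\<noteq>) ((=) :: bool \<Rightarrow> _)"])
        (auto simp: satisfies_iffs)
  next
    \<comment> \<open>The product of a left zero semigroup and addition modulo 2, with the left quotients spoiled
      where the left zero coordinates differ.  In \<open>x \<setminus> (x \<cdot> y)\<close> and in
      \<open>y \<setminus> y\<close> they agree, and \<open>(x \<setminus> y) \<setminus> ((x \<setminus> y) \<cdot> z)\<close> depends on \<open>x \<setminus> y\<close> only through its left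
      zero coordinate, so among the axioms only (Q3) sees the change.\<close>
    case 3
    show ?thesis
      unfolding 3 by (rule countable_witness[of "on_type
          (\<lambda>(c :: bool, s) (d, t). (c, s \<noteq> t))
          (\<lambda>(c, s) (d, t). (c, c = d \<and> s \<noteq> t))
          (\<lambda>(c, s) (d, t). (c, s \<noteq> t))"])
        (auto simp: satisfies_iffs)
  next
    \<comment> \<open>The mirror image of the previous algebra.\<close>
    case 4
    show ?thesis
      unfolding 4 by (rule countable_witness[of "on_type
          (\<lambda>(c :: bool, s) (d, t). (d, s \<noteq> t))
          (\<lambda>(c, s) (d, t). (d, s \<noteq> t))
          (\<lambda>(c, s) (d, t). (d, c = d \<and> s \<noteq> t))"])
        (auto simp: satisfies_iffs)
  next
    \<comment> \<open>Both divisions return the dividend, and (Q5) becomes \<open>y = x\<close>.\<close>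
    case 5
    show ?thesis
      unfolding 5 by (rule countable_witness[of "on_type
          (\<lambda>x y. x) (\<lambda>x y. y) (\<lambda>x (y :: bool). x)"])
        (auto simp: satisfies_iffs)
  next
    \<comment> \<open>Both divisions return the dividend, and (Q6) becomes \<open>z = u\<close>.\<close>
    case 6
    show ?thesis
      unfolding 6 by (rule countable_witness[of "on_type
          (\<lambda>x y. y) (\<lambda>x y. y) (\<lambda>x (y :: bool). x)"])
        (auto simp: satisfies_iffs)
  next
    \<comment> \<open>A quasigroup with \<open>y \<setminus> y = 0\<close> but \<open>x \<sslash> x = 2 * x\<close>.\<close>
    case 7
    show ?thesis
      unfolding 7 by (rule countable_witness[of "on_type (-) (-) ((+) :: int \<Rightarrow> _)"])
        (auto simp: satisfies_iffs intro: exI[of _ 1])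
  qed
qed


section \<open>The axiom systems\<close>

theorem theorem1p1:
  shows "(axiom_system {eqQ1, eqQ2, eqQ3, eqQ4, eqQ5, eqQ6}
            (rectangular_quasigroup :: 'a algebra3 \<Rightarrow> bool) \<and>
          independent_equations {eqQ1, eqQ2, eqQ3, eqQ4, eqQ5, eqQ6}) \<and>
         (axiom_system {eqQ1, eqQ2, eqQ3, eqQ4, eqQ5, eqQ6, eqL}
            (rectangular_loop :: 'a algebra3 \<Rightarrow> bool) \<and>
          independent_equations {eqQ1, eqQ2, eqQ3, eqQ4, eqQ5, eqQ6, eqL})"
proof -
  have quasigroups: "rectangular_quasigroup M \<longleftrightarrow> (\<forall>e\<in>rectangular_axioms. M \<^bold>\<Turnstile> e)"
    if "is_algebra3 M" for M :: "'a algebra3"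
    using rectangular_quasigroup_satisfies rectangular_quasigroup_of_axioms[OF that] by blast
  have "{eqQ1, eqQ2, eqQ3, eqQ4, eqQ5, eqQ6, eqL} = insert eqL rectangular_axioms"
    by blast
  moreover have "independent_equations rectangular_axioms"
    by (rule independent_equations_subset[OF independent_rectangular_loop_axioms]) blast
  ultimately show ?thesis
    using independent_rectangular_loop_axioms quasigroups
    by (simp add: axiom_system_def rectangular_loop_iff conj_commute)
qed

end
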